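(* Let $\lambda$ be a non-empty integer partition of $n=|\lambda|$, with external hook $s$ and center $c$, and let $a=\lambda_a^1$, $b=\lambda_b^1$ denote the truncated first row and truncated first column of $\lambda$. (a) We have $$H(\lambda,\lambda)=\frac{|s|!}{\binom{|s|-1}{|b|}}\;\frac{H(\lambda,a)}{H(a,a)}\;\frac{H(\lambda,b)}{H(b,b)}\;H(c,c),$$ and in particular $$\frac{d_\lambda}{\binom{n}{|c|}d_s d_c}=\frac{H(a,a)}{H(\lambda,a)}\;\frac{H(b,b)}{H(\lambda,b)}.$$ (b) We have $$\frac{d_\lambda}{\binom{n}{|c|}d_sd_c}\ge e^{-6\sqrt{|c|}}.$$
   Context: Integer partitions are identified with their Young diagrams, drawn in the French convention: a finite set of boxes, row $i$ (from the bottom) having $\lambda_i$ boxes, left-justified. The external hook $s$ of $\lambda$ is the union of its first row and first column; the center $c=\lambda\setminus s$ is the diagram left after removing the first row and first column (possibly empty). The truncated first row $a=\lambda_a^1$ (resp. truncated first column $b=\lambda_b^1$) is the first row (resp. first column) of $\lambda$ without the corner box $(1,1)$; thus $|a|=\lambda_1-1$, $|b|=\lambda_1'-1$, $|s|=|a|+|b|+1$ and $n=|s|+|c|$. For a finite set of boxes $S\subset\mathbb{Z}^2$ and $u=(x,y)$, $H(S,u)=\left|\{(x',y')\in S:\ [x'=x,\ y'\ge y]\text{ or }[y'=y,\ x'\ge x]\}\right|$, and for a set $E$ of boxes $H(S,E)=\prod_{u\in E}H(S,u)$ (empty product equal to 1). For a Young diagram $\mu$, $d_\mu$ is the number of standard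 Young tableaux of shape $\mu$, with $d_\emptyset=1$. *)

theory Defs
  imports Complex_Main "HOL-Library.FuncSet"
begin

definition is_partition :: "nat list \<Rightarrow> bool" where
  "is_partition lam \<longleftrightarrow> sorted_wrt (\<ge>) lam \<and> (\<forall>p\<in>set lam. p > 0)"

text \<open>A box is a pair \<open>(x, y)\<close>, where \<open>x\<close> is its column and \<open>y\<close> its row, both counted from 1;
  rows are counted from the bottom (French convention). List indices start at 0, so row \<open>y\<close> has
  \<open>lam ! (y - 1)\<close> boxes.\<close>

type_synonym box = "int \<times> int"

definition diagram :: "nat list \<Rightarrow> box set" where
  "diagram lam = {(x, y). 1 \<le> y \<and> y \<le> int (length lam) \<and> 1 \<le> x \<and> x \<le> int (lam ! nat (y - 1))}"

definition first_row :: "box set \<Rightarrow> box set" where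
  "first_row D = {u \<in> D. snd u = 1}"

definition first_column :: "box set \<Rightarrow> box set" where
  "first_column D = {u \<in> D. fst u = 1}"

definition external_hook :: "box set \<Rightarrow> box set" where
  "external_hook D = first_row D \<union> first_column D"

text \<open>The center is kept in place as a set of boxes: it is a Young diagram translated by
  \<open>(1, 1)\<close>. Hook lengths and standard tableaux are defined below for arbitrary sets of
  boxes, and are translation invariant, so the center needs no renormalization.\<close>

definition center :: "box set \<Rightarrow> box set" where
  "center D = D - external_hook D"

definition trunc_row :: "box set \<Rightarrow> box set" where
  "trunc_row D = first_row D - {(1, 1)}"

definition trunc_column :: "box set \<Rightarrow> box set" where
  "trunc_column D = first_column D - {(1, 1)}"

definition hook_length :: "box set \<Rightarrow> box \<Rightarrow> nat" where
  "hook_length S u = card {v \<in> S. (fst v = fst u \<and> snd v \<ge> snd u) \<or> (snd v = snd u \<and> fst v \<ge> fst u)}"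

definition hook_prod :: "box set \<Rightarrow> box set \<Rightarrow> nat" where
  "hook_prod S E = (\<Prod>u\<in>E. hook_length S u)"

text \<open>Tableaux are extensional functions (\<open>undefined\<close> outside the shape), so that each
  filling of a shape is counted once; in particular the empty shape has exactly one.\<close>

definition standard_tableaux :: "box set \<Rightarrow> (box \<Rightarrow> nat) set" where
  "standard_tableaux S = {T \<in> extensional S. bij_betw T S {1..card S} \<and>
     (\<forall>x x' y. (x, y) \<in> S \<longrightarrow> (x', y) \<in> S \<longrightarrow> x < x' \<longrightarrow> T (x, y) < T (x', y)) \<and>
     (\<forall>x y y'. (x, y) \<in> S \<longrightarrow> (x, y') \<in> S \<longrightarrow> y < y' \<longrightarrow> T (x, y) < T (x, y'))}"

definition num_syt :: "box set \<Rightarrow> nat" where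
  "num_syt S = card (standard_tableaux S)"

end

(* The factorization in (a) sorts the boxes of the diagram into corner box, truncated row, truncated
   column and center; a hook based in the center stays in the center. The identity for d then follows
   from the hook length formula, applied to the diagram, its external hook and its center.

   The hook length formula is proved by induction on the number of boxes from
   card D = sum over corners c of H(D) / H(D - c). For a corner c = (m, k), the probability that the
   Greene-Nijenhuis-Wilf hook walk from (x, y) ends in c factors as f(x) g(y). These weights satisfy
   the hook recursion because h(x, y) - 1 = (h(x, k) - 1) + (h(m, y) - 1) and the sums of f and of g
   telescope. They add up to 1 over all corners, and to H(D) / H(D - c) over all boxes.

   For (b), let g_0 <= g_1 <= ... be the column heights of the center, from right to left and zero
   allowed. The ratio H(D, a) / H(a, a) is the product of the 1 + g_i / (i + 1), and
   1 + x <= exp (sqrt x). By Chebyshev's sum inequality, the sum over i < k of sqrt (g_i / (i + 1)) is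
   at most 1/k * sqrt (k * card c) * 2 * sqrt k, so the ratio is at most exp (2 * sqrt (card c)). The
   same holds for the column, which gives the bound even with 4 in place of 6. *)

theory Submission
  imports Defs
begin

subsection \<open>The hook length formula\<close>

text \<open>Makes every row and column of a diagram an interval that starts at the base point. The
  offset \<open>p - 1\<close> covers the empty set as \<open>{p..p - 1}\<close>.\<close>

lemma down_closed_int_set_eq:
  fixes A :: "int set"
  assumes "finite A" and "\<And>x. x \<in> A \<Longrightarrow> p \<le> x"
    and "\<And>x x'. x \<in> A \<Longrightarrow> p \<le> x' \<Longrightarrow> x' \<le> x \<Longrightarrow> x' \<in> A"
  shows "A = {p..p - 1 + int (card A)}"
proof (cases "A = {}")
  case False
  have "A = {p..Max A}"
    using assms(2) assms(3)[OF Max_in[OF assms(1) False]] Max_ge[OF assms(1)]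
    unfolding atLeastAtMost_def atLeast_def atMost_def by blast
  moreover from this have "p \<le> Max A" using False by auto
  ultimately have "int (card A) = Max A - p + 1"
    using card_atLeastAtMost_int[of p "Max A"] by simp
  with \<open>A = {p..Max A}\<close> show ?thesis by simp
qed simp

text \<open>Let P(i) be the product over \<open>{i..<m}\<close>. From P(i) = (1 + 1 / X i) P(i+1),
  the summand at i < m is P(i) - P(i+1), and the summand 1 at \<open>m\<close> is the empty product
  P(m).\<close>

lemma sum_telescoping_weights:
  fixes X :: "int \<Rightarrow> real"
  assumes "a \<le> m" and "\<And>i. a \<le> i \<Longrightarrow> i < m \<Longrightarrow> X i \<noteq> 0"
  shows "(\<Sum>i\<in>{a..m}. if i = m then 1 else (\<Prod>j\<in>{i+1..<m}. 1 + 1 / X j) / X i)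
    = (\<Prod>j\<in>{a..<m}. 1 + 1 / X j)"
  using assms
proof (induction a rule: int_le_induct)
  case base
  then show ?case by simp
next
  case (step i)
  define w where "w \<equiv> \<lambda>i. if i = m then 1 else (\<Prod>j\<in>{i+1..<m}. 1 + 1 / X j) / X i"
  have s: "{i - 1..m} = insert (i - 1) {i..m}" and t: "{i - 1..<m} = insert (i - 1) {i..<m}"
    using step.hyps by auto
  have "(\<Sum>i\<in>{i - 1..m}. w i) = w (i - 1) + (\<Sum>i\<in>{i..m}. w i)"
    unfolding s by simp
  also have "\<dots> = (\<Prod>j\<in>{i - 1..<m}. 1 + 1 / X j)"
    using step unfolding t w_def by (simp add: field_simps)
  finally show ?case unfolding w_def .
qed

lemma finite_standard_tableaux:
  assumes "finite S"
  shows "finite (standard_tableaux S)"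
proof (rule finite_subset)
  show "standard_tableaux S \<subseteq> S \<rightarrow>\<^sub>E {1..card S}"
    by (auto simp: standard_tableaux_def PiE_def bij_betw_def)
  show "finite (S \<rightarrow>\<^sub>E {1..card S})"
    using assms by (intro finite_PiE) auto
qed

section \<open>Rows, columns and hooks of a diagram\<close>

text \<open>The base point \<open>(p, q)\<close> is a parameter so that the center of a diagram, which starts at
  \<open>(2, 2)\<close>, is an instance without translation.\<close>

locale young =
  fixes p q :: int and D :: "box set"
  assumes finite_D: "finite D"
    and base: "(x, y) \<in> D \<Longrightarrow> p \<le> x \<and> q \<le> y"
    and down: "(x, y) \<in> D \<Longrightarrow> p \<le> x' \<Longrightarrow> x' \<le> x \<Longrightarrow> q \<le> y' \<Longrightarrow> y' \<le> y \<Longrightarrow> (x', y') \<in> D"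
begin

text \<open>Counting gives an empty row the end \<open>p - 1\<close>, just before the first column,
  so that \<open>mem_iff_row\<close> holds for every \<open>y\<close>; likewise for columns.\<close>

definition row_end :: "int \<Rightarrow> int" where "row_end y = p - 1 + int (card {x. (x, y) \<in> D})"
definition col_end :: "int \<Rightarrow> int" where "col_end x = q - 1 + int (card {y. (x, y) \<in> D})"

lemma mem_iff_row: "(x, y) \<in> D \<longleftrightarrow> p \<le> x \<and> x \<le> row_end y"
proof -
  have "finite {x. (x, y) \<in> D}"
    by (rule finite_subset[OF _ finite_imageI[OF finite_D, of fst]]) force
  then have "{x. (x, y) \<in> D} = {p..row_end y}"
    unfolding row_end_def by (rule down_closed_int_set_eq) (use base down in blast)+
  then show ?thesis by auto
qed

lemma mem_iff_col: "(x, y) \<in> D \<longleftrightarrow> q \<le> y \<and> y \<le> col_end x"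
proof -
  have "finite {y. (x, y) \<in> D}"
    by (rule finite_subset[OF _ finite_imageI[OF finite_D, of snd]]) force
  then have "{y. (x, y) \<in> D} = {q..col_end x}"
    unfolding col_end_def by (rule down_closed_int_set_eq) (use base down in blast)+
  then show ?thesis by auto
qed

lemma hook_set_eq:
  assumes "(x, y) \<in> D"
  shows "{v \<in> D. (fst v = x \<and> snd v \<ge> y) \<or> (snd v = y \<and> fst v \<ge> x)}
    = insert (x, y) ((\<lambda>i. (i, y)) ` {x+1..row_end y} \<union> Pair x ` {y+1..col_end x})"
proof -
  have xy: "p \<le> x" "q \<le> y" using base[OF assms] by auto
  have "i \<le> row_end y \<longleftrightarrow> (i, y) \<in> D" if "x \<le> i" for i using that xy mem_iff_row[of i y] by auto
  moreover have "j \<le> col_end x \<longleftrightarrow> (x, j) \<in> D" if "y \<le> j" for j using that xy mem_iff_col[of x j] by auto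
  ultimately show ?thesis using assms by (force simp: image_iff)
qed

lemma sum_hook:
  assumes "(x, y) \<in> D"
  shows "sum f {v \<in> D. (fst v = x \<and> snd v \<ge> y) \<or> (snd v = y \<and> fst v \<ge> x)}
    = f (x, y) + (\<Sum>i\<in>{x+1..row_end y}. f (i, y)) + (\<Sum>j\<in>{y+1..col_end x}. f (x, j))"
proof -
  have "sum f ((\<lambda>i. (i, y)) ` {x+1..row_end y} \<union> Pair x ` {y+1..col_end x})
    = (\<Sum>i\<in>{x+1..row_end y}. f (i, y)) + (\<Sum>j\<in>{y+1..col_end x}. f (x, j))"
    by (subst sum.union_disjoint) (auto simp: sum.reindex inj_on_def)
  then show ?thesis
    unfolding hook_set_eq[OF assms] by (subst sum.insert) (auto simp: add.assoc)
qed

text \<open>Arm plus leg plus one, stated over the integers so that no subtraction is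
  truncated.\<close>

lemma hook_length_eq:
  assumes "(x, y) \<in> D"
  shows "int (hook_length D (x, y)) = row_end y - x + (col_end x - y) + 1"
proof -
  have "hook_length D (x, y) = 1 + nat (row_end y - x) + nat (col_end x - y)"
    unfolding hook_length_def card_eq_sum fst_conv snd_conv sum_hook[OF assms]
    by (simp flip: card_eq_sum)
  moreover have "x \<le> row_end y" "y \<le> col_end x" using assms mem_iff_row[of x y] mem_iff_col[of x y] by blast+
  ultimately show ?thesis by simp
qed

lemma hook_length_pos: "u \<in> D \<Longrightarrow> hook_length D u > 0"
  using hook_length_eq[of "fst u" "snd u"] mem_iff_row[of "fst u" "snd u"] mem_iff_col[of "fst u" "snd u"]
  by simp

section \<open>Corners of a diagram\<close>

definition corners :: "box set" where
  "corners = {(x, y) \<in> D. (x + 1, y) \<notin> D \<and> (x, y + 1) \<notin> D}"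

lemma cornerD:
  assumes "(x, y) \<in> corners"
  shows "(x, y) \<in> D" "row_end y = x" "col_end x = y"
proof -
  show D: "(x, y) \<in> D" using assms by (simp add: corners_def)
  have "(x + 1, y) \<notin> D" "(x, y + 1) \<notin> D" using assms by (auto simp: corners_def)
  with D mem_iff_row[of x y] mem_iff_col[of x y] mem_iff_row[of "x+1" y] mem_iff_col[of x "y+1"]
  show "row_end y = x" "col_end x = y" by linarith+
qed

lemma finite_corners: "finite corners"
  using finite_D by (rule rev_finite_subset) (auto simp: corners_def)

text \<open>A strict inequality in one coordinate would put the right or upper neighbour of the
  smaller corner into \<open>D\<close>.\<close>

lemma corners_incomparable:
  assumes "(x, y) \<in> corners" "(x', y') \<in> corners" "x \<le> x'" "y \<le> y'"
  shows "x = x' \<and> y = y'"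
proof -
  have "(x + 1, y) \<notin> D" "(x, y + 1) \<notin> D" using assms(1) by (auto simp: corners_def)
  moreover have "(x + 1, y) \<in> D" if "x < x'"
    using down[OF cornerD(1)[OF assms(2)], of "x + 1" y] base[OF cornerD(1)[OF assms(1)]] that assms(4) by auto
  moreover have "(x, y + 1) \<in> D" if "y < y'"
    using down[OF cornerD(1)[OF assms(2)], of x "y + 1"] base[OF cornerD(1)[OF assms(1)]] that assms(3) by auto
  ultimately show ?thesis using assms(3,4) by (metis order_le_less)
qed

lemma young_remove_corner:
  assumes "c \<in> corners"
  shows "young p q (D - {c})"
proof
  fix x y x' y' assume h: "(x, y) \<in> D - {c}" "p \<le> x'" "x' \<le> x" "q \<le> y'" "y' \<le> y"
  obtain m k where c: "c = (m, k)" by fastforce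
  have "(x, y) \<in> D" "(x', y') \<in> D" using h down by auto
  moreover have "(x', y') \<noteq> c"
  proof
    assume e: "(x', y') = c"
    then have "(m, k) \<in> corners" "m \<le> x" "k \<le> y" "(x,y) \<noteq> (m,k)" using assms h c by auto
    \<comment> \<open>These two boxes share a column and a row with the corner, which ends both;
      hence y \<le> k and x \<le> m, and \<open>(x, y)\<close> would be the corner itself.\<close>
    moreover have "(m, y) \<in> D" "(x, k) \<in> D"
      using h e c down[of x y] by auto
    ultimately show False using cornerD[of m k] mem_iff_row[of x k] mem_iff_col[of m y] by auto
  qed
  ultimately show "(x', y') \<in> D - {c}" by auto
qed (use finite_D base in auto)

section \<open>Weights of the hook walk\<close>

text \<open>The hook walk of Greene, Nijenhuis and Wilf from a box \<open>(x, y)\<close> ends in the corner \<open>(m, k)\<close>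
  with probability \<open>walk_weight m k (x, y)\<close>.\<close>

definition row_weight :: "int \<Rightarrow> int \<Rightarrow> int \<Rightarrow> real" where
  "row_weight m k x = (if x = m then 1 else
     (\<Prod>j\<in>{x+1..<m}. 1 + 1 / (real (hook_length D (j, k)) - 1)) / (real (hook_length D (x, k)) - 1))"

text \<open>Expanding the product gives a sum over the possible sets of rows visited strictly
  between \<open>y\<close> and \<open>k\<close>; each visited row, and \<open>y\<close> itself,
  contributes the reciprocal of a hook length minus one. \<open>row_weight\<close> does the same for
  columns.\<close>

definition col_weight :: "int \<Rightarrow> int \<Rightarrow> int \<Rightarrow> real" where
  "col_weight m k y = (if y = k then 1 else
     (\<Prod>j\<in>{y+1..<k}. 1 + 1 / (real (hook_length D (m, j)) - 1)) / (real (hook_length D (m, y)) - 1))"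

definition walk_weight :: "int \<Rightarrow> int \<Rightarrow> box \<Rightarrow> real" where
  "walk_weight m k u = (if fst u \<le> m \<and> snd u \<le> k then row_weight m k (fst u) * col_weight m k (snd u) else 0)"

text \<open>The arm of \<open>(x, y)\<close> splits at column \<open>m\<close> into m - x, the arm
  of \<open>(x, k)\<close>, and the arm of \<open>(m, y)\<close>. Its leg splits at row
  \<open>k\<close> into the leg of \<open>(m, y)\<close> and that of \<open>(x, k)\<close>.\<close>

lemma hook_additive:
  assumes "(m, k) \<in> corners" "p \<le> x" "x \<le> m" "q \<le> y" "y \<le> k"
  shows "real (hook_length D (x, y)) - 1 = (real (hook_length D (x, k)) - 1) + (real (hook_length D (m, y)) - 1)"
proof -
  have "(m, k) \<in> D" using cornerD assms by blast
  then have "(x, y) \<in> D" "(x, k) \<in> D" "(m, y) \<in> D" using assms down[of m k] base[of m k] by auto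
  then have "int (hook_length D (x, y)) - 1 = (int (hook_length D (x, k)) - 1) + (int (hook_length D (m, y)) - 1)"
    using cornerD[OF assms(1)] by (simp add: hook_length_eq)
  then show ?thesis by linarith
qed

lemma hook_gt_1_row:
  assumes "(m, k) \<in> corners" "p \<le> x" "x < m"
  shows "hook_length D (x, k) > 1"
proof -
  have "(x, k) \<in> D" using assms cornerD[OF assms(1)] down[of m k x k] base[of m k] by auto
  then show ?thesis using hook_length_eq[of x k] cornerD[OF assms(1)] mem_iff_col[of x k] assms by auto
qed

lemma hook_gt_1_col:
  assumes "(m, k) \<in> corners" "q \<le> y" "y < k"
  shows "hook_length D (m, y) > 1"
proof -
  have "(m, y) \<in> D" using assms cornerD[OF assms(1)] down[of m k m y] base[of m k] by auto
  then show ?thesis using hook_length_eq[of m y] cornerD[OF assms(1)] mem_iff_row[of m y] assms by auto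
qed

lemma hook_corner: "(m, k) \<in> corners \<Longrightarrow> hook_length D (m, k) = 1"
  using hook_length_eq[of m k] cornerD[of m k] by simp

lemma sum_row_weight:
  assumes "(m, k) \<in> corners" "p \<le> x" "x \<le> m"
  shows "(\<Sum>i\<in>{x..m}. row_weight m k i) = (\<Prod>j\<in>{x..<m}. 1 + 1 / (real (hook_length D (j, k)) - 1))"
  unfolding row_weight_def
proof (rule sum_telescoping_weights[OF assms(3)])
  fix i assume "x \<le> i" "i < m"
  then show "real (hook_length D (i, k)) - 1 \<noteq> 0" using hook_gt_1_row[OF assms(1), of i] assms(2) by simp
qed

lemma sum_col_weight:
  assumes "(m, k) \<in> corners" "q \<le> y" "y \<le> k"
  shows "(\<Sum>i\<in>{y..k}. col_weight m k i) = (\<Prod>j\<in>{y..<k}. 1 + 1 / (real (hook_length D (m, j)) - 1))"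
  unfolding col_weight_def
proof (rule sum_telescoping_weights[OF assms(3)])
  fix i assume "y \<le> i" "i < k"
  then show "real (hook_length D (m, i)) - 1 \<noteq> 0" using hook_gt_1_col[OF assms(1), of i] assms(2) by simp
qed

text \<open>For x < m the weight is the telescoped sum from x + 1 on, divided by the hook length
  minus one. At x = m both sides vanish, since a corner has hook length 1.\<close>

lemma tail_row_weight:
  assumes "(m, k) \<in> corners" "p \<le> x" "x \<le> m"
  shows "(\<Sum>i\<in>{x+1..m}. row_weight m k i) = (real (hook_length D (x, k)) - 1) * row_weight m k x"
proof (cases "x = m")
  case True
  then show ?thesis using hook_corner assms by simp
next
  case False
  then show ?thesis
    using sum_row_weight[OF assms(1), of "x + 1"] hook_gt_1_row[OF assms(1,2)] assms by (simp add: row_weight_def)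
qed

lemma tail_col_weight:
  assumes "(m, k) \<in> corners" "q \<le> y" "y \<le> k"
  shows "(\<Sum>i\<in>{y+1..k}. col_weight m k i) = (real (hook_length D (m, y)) - 1) * col_weight m k y"
proof (cases "y = k")
  case True
  then show ?thesis using hook_corner assms by simp
next
  case False
  then show ?thesis
    using sum_col_weight[OF assms(1), of "y + 1"] hook_gt_1_col[OF assms(1,2)] assms by (simp add: col_weight_def)
qed

text \<open>One step of the walk: the weight of a box is the average of the weights over the rest of
  its hook. The row sum contributes the factor h(x, k) - 1, the column sum h(m, y) - 1, and
  \<open>hook_additive\<close> adds them.\<close>

lemma walk_weight_recursion:
  assumes c: "(m, k) \<in> corners" and u: "(x, y) \<in> D"
  shows "(\<Sum>i\<in>{x+1..row_end y}. walk_weight m k (i, y)) + (\<Sum>j\<in>{y+1..col_end x}. walk_weight m k (x, j))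
    = (real (hook_length D (x, y)) - 1) * walk_weight m k (x, y)"
proof (cases "x \<le> m \<and> y \<le> k")
  case True
  have xy: "p \<le> x" "q \<le> y" using base[OF u] by auto
  have "(m, y) \<in> D" "(x, k) \<in> D" using True xy down[OF cornerD(1)[OF c]] base[OF cornerD(1)[OF c]] by auto
  then have le: "m \<le> row_end y" "k \<le> col_end x" by (simp_all add: mem_iff_row[of m y] mem_iff_col[of x k])
  \<comment> \<open>Boxes beyond column \<open>m\<close> or row \<open>k\<close> have weight 0,
    since the walk never moves left or down; this cuts both sums at the corner.\<close>
  have "(\<Sum>i\<in>{x+1..row_end y}. walk_weight m k (i, y)) = (\<Sum>i\<in>{x+1..m}. row_weight m k i * col_weight m k y)"
    by (rule sum.mono_neutral_cong_right) (use le True in \<open>auto simp: walk_weight_def\<close>)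
  moreover have "(\<Sum>j\<in>{y+1..col_end x}. walk_weight m k (x, j)) = (\<Sum>j\<in>{y+1..k}. row_weight m k x * col_weight m k j)"
    by (rule sum.mono_neutral_cong_right) (use le True in \<open>auto simp: walk_weight_def\<close>)
  moreover have "walk_weight m k (x, y) = row_weight m k x * col_weight m k y" using True by (simp add: walk_weight_def)
  ultimately show ?thesis
    unfolding sum_distrib_left[symmetric] sum_distrib_right[symmetric]
    using True xy by (simp only: tail_row_weight[OF c] tail_col_weight[OF c] hook_additive[OF c]) (simp add: algebra_simps)
next
  case False
  then show ?thesis by (auto simp: walk_weight_def intro!: sum.neutral)
qed

text \<open>Every hook walk ends in some corner. The induction runs downwards on x + y from an upper
  bound \<open>N\<close>, as all other boxes of a hook have a larger coordinate sum.\<close>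

lemma sum_walk_weight_corners:
  assumes "u \<in> D"
  shows "(\<Sum>(m, k)\<in>corners. walk_weight m k u) = 1"
proof -
  have "finite ((\<lambda>(x, y). x + y) ` D)" using finite_D by blast
  then obtain N where N: "\<And>x y. (x, y) \<in> D \<Longrightarrow> x + y \<le> N"
    by (metis Max_ge case_prod_conv image_eqI)
  show ?thesis using assms
  proof (induction "nat (N - fst u - snd u)" arbitrary: u rule: less_induct)
    case less
    obtain x y where u: "u = (x, y)" by fastforce
    define h where "h = real (hook_length D (x, y))"
    have xy: "(x, y) \<in> D" using less u by simp
    have one: "(\<Sum>(m, k)\<in>corners. walk_weight m k (i, j)) = 1" if "(i, j) \<in> D" "i + j > x + y" for i j
      using less.hyps[of "(i, j)"] that N[of i j] by (simp add: u)
    have "(\<Sum>i\<in>{x+1..row_end y}. \<Sum>(m, k)\<in>corners. walk_weight m k (i, y)) = (\<Sum>i\<in>{x+1..row_end y}. 1)"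
      using xy by (intro sum.cong refl one) (auto simp: mem_iff_row)
    moreover have "(\<Sum>j\<in>{y+1..col_end x}. \<Sum>(m, k)\<in>corners. walk_weight m k (x, j)) = (\<Sum>j\<in>{y+1..col_end x}. 1)"
      using xy by (intro sum.cong refl one) (auto simp: mem_iff_col)
    moreover have "(\<Sum>i\<in>{x+1..row_end y}. \<Sum>(m, k)\<in>corners. walk_weight m k (i, y))
        + (\<Sum>j\<in>{y+1..col_end x}. \<Sum>(m, k)\<in>corners. walk_weight m k (x, j))
        = (\<Sum>(m, k)\<in>corners. (h - 1) * walk_weight m k (x, y))"
      by (subst (1 2) sum.swap, subst sum.distrib[symmetric])
        (auto intro!: sum.cong simp: walk_weight_recursion[OF _ xy] h_def)
    moreover have "(\<Sum>i\<in>{x+1..row_end y}. 1) + (\<Sum>j\<in>{y+1..col_end x}. 1) = h - 1"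
      using hook_length_eq[OF xy] xy mem_iff_row[of x y] mem_iff_col[of x y] unfolding h_def by simp
    \<comment> \<open>Each of the h - 1 other boxes of the hook contributes 1 by induction. This
      settles the claim unless h = 1.\<close>
    ultimately have eq: "(h - 1) * (\<Sum>(m, k)\<in>corners. walk_weight m k (x, y)) = h - 1"
      by (simp add: sum_distrib_left case_prod_unfold)
    show ?case
    proof (cases "h = 1")
      case True
      then have "row_end y = x" "col_end x = y"
        using hook_length_eq[OF xy] xy mem_iff_row[of x y] mem_iff_col[of x y] unfolding h_def by auto
      then have c: "(x, y) \<in> corners"
        using xy mem_iff_row[of "x+1" y] mem_iff_col[of x "y+1"] by (auto simp: corners_def)
      \<comment> \<open>The box is itself a corner; by incomparability all other corners have weight
        0 there.\<close>
      have "(\<Sum>(m, k)\<in>corners. walk_weight m k (x, y)) = (\<Sum>v\<in>{(x, y)}. case v of (m, k) \<Rightarrow> walk_weight m k (x, y))"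
        by (rule sum.mono_neutral_right)
          (use c finite_corners in \<open>auto simp: walk_weight_def split: if_splits dest: corners_incomparable[OF c]\<close>)
      then show ?thesis by (simp add: u walk_weight_def row_weight_def col_weight_def)
    qed (use eq u in auto)
  qed
qed

text \<open>Only the rectangle to the left of and below the corner carries weight, and the sum over
  a rectangle factors.\<close>

lemma sum_walk_weight:
  assumes c: "(m, k) \<in> corners"
  shows "(\<Sum>u\<in>D. walk_weight m k u) = (\<Prod>j\<in>{p..<m}. 1 + 1 / (real (hook_length D (j, k)) - 1))
    * (\<Prod>j\<in>{q..<k}. 1 + 1 / (real (hook_length D (m, j)) - 1))"
proof -
  have mk: "p \<le> m" "q \<le> k" using base[OF cornerD(1)[OF c]] by auto
  have "(\<Sum>u\<in>D. walk_weight m k u) = (\<Sum>u\<in>{p..m} \<times> {q..k}. row_weight m k (fst u) * col_weight m k (snd u))"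
    by (rule sum.mono_neutral_cong_right)
      (use finite_D base down[OF cornerD(1)[OF c]] in \<open>auto simp: walk_weight_def\<close>)
  also have "\<dots> = (\<Sum>x\<in>{p..m}. row_weight m k x) * (\<Sum>y\<in>{q..k}. col_weight m k y)"
    by (simp add: sum_product sum.cartesian_product case_prod_unfold)
  finally show ?thesis using sum_row_weight[OF c _ mk(1)] sum_col_weight[OF c _ mk(2)] by simp
qed

section \<open>Hook products after the removal of a corner\<close>

lemma hook_length_remove_corner:
  assumes c: "(m, k) \<in> corners" and u: "(x, y) \<in> D" "(x, y) \<noteq> (m, k)"
  shows "hook_length (D - {(m, k)}) (x, y) = (if x = m \<or> y = k then hook_length D (x, y) - 1 else hook_length D (x, y))"
proof -
  let ?H = "{v \<in> D. (fst v = x \<and> snd v \<ge> y) \<or> (snd v = y \<and> fst v \<ge> x)}"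
  have "{v \<in> D - {(m, k)}. (fst v = x \<and> snd v \<ge> y) \<or> (snd v = y \<and> fst v \<ge> x)} = ?H - {(m, k)}"
    by auto
  moreover have "(m, k) \<in> ?H \<longleftrightarrow> x = m \<or> y = k"
    using cornerD[OF c] u mem_iff_row[of x y] mem_iff_col[of x y] by auto
  moreover have "finite ?H" using finite_D by simp
  ultimately show ?thesis unfolding hook_length_def by (simp add: card_Diff_singleton_if)
qed

text \<open>Only the hooks based in the row or column of the corner change. Each loses one box, and
  h / (h - 1) = 1 + 1 / (h - 1) is the matching factor of the total walk weight.\<close>

lemma hook_prod_remove_corner:
  assumes c: "(m, k) \<in> corners"
  shows "real (hook_prod D D) / real (hook_prod (D - {(m, k)}) (D - {(m, k)})) = (\<Sum>u\<in>D. walk_weight m k u)"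
proof -
  define E where "E = D - {(m, k)}"
  define r where "r u = real (hook_length D u) / real (hook_length E u)" for u
  have mk: "(m, k) \<in> D" "p \<le> m" "q \<le> k" using base[OF cornerD(1)[OF c]] cornerD[OF c] by auto
  interpret E: young p q E unfolding E_def by (rule young_remove_corner[OF c])
  let ?A = "(\<lambda>x. (x, k)) ` {p..<m}" and ?B = "Pair m ` {q..<k}"
  have "real (hook_prod D D) = (\<Prod>u\<in>E. real (hook_length D u))"
    unfolding hook_prod_def E_def using finite_D mk hook_corner[OF c] by (simp add: prod.remove)
  then have "real (hook_prod D D) / real (hook_prod E E) = (\<Prod>u\<in>E. r u)"
    unfolding hook_prod_def r_def by (simp add: prod_dividef)
  also have "\<dots> = (\<Prod>u\<in>?A \<union> ?B. r u)"
  proof (rule prod.mono_neutral_right)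
    show "finite E" by (rule E.finite_D)
    show "?A \<union> ?B \<subseteq> E" using mk down[OF mk(1)] by (auto simp: E_def)
    show "\<forall>i\<in>E - (?A \<union> ?B). r i = 1"
    proof
      fix i assume i: "i \<in> E - (?A \<union> ?B)"
      obtain x y where xy: "i = (x, y)" by fastforce
      \<comment> \<open>The corner ends its row and its column, so \<open>?A\<close> and
        \<open>?B\<close> exhaust the other boxes there.\<close>
      have "x \<noteq> m" "y \<noteq> k"
        using i xy base[of x y] mem_iff_row[of x y] mem_iff_col[of x y] cornerD[OF c] by (auto simp: E_def)
      then show "r i = 1"
        using i xy hook_length_remove_corner[OF c, of x y] hook_length_pos[of i]
        by (auto simp: r_def E_def)
    qed
  qed
  also have "\<dots> = (\<Prod>x\<in>{p..<m}. r (x, k)) * (\<Prod>y\<in>{q..<k}. r (m, y))"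
    by (subst prod.union_disjoint) (auto simp: prod.reindex inj_on_def)
  also have "(\<Prod>x\<in>{p..<m}. r (x, k)) = (\<Prod>j\<in>{p..<m}. 1 + 1 / (real (hook_length D (j, k)) - 1))"
  proof (rule prod.cong[OF refl])
    fix x assume x: "x \<in> {p..<m}"
    then have "hook_length E (x, k) = hook_length D (x, k) - 1"
      using hook_length_remove_corner[OF c, of x k] down[OF mk(1), of x k] mk by (auto simp: E_def)
    then show "r (x, k) = 1 + 1 / (real (hook_length D (x, k)) - 1)"
      using x hook_gt_1_row[OF c, of x] by (auto simp: r_def of_nat_diff field_simps)
  qed
  also have "(\<Prod>y\<in>{q..<k}. r (m, y)) = (\<Prod>j\<in>{q..<k}. 1 + 1 / (real (hook_length D (m, j)) - 1))"
  proof (rule prod.cong[OF refl])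
    fix y assume y: "y \<in> {q..<k}"
    then have "hook_length E (m, y) = hook_length D (m, y) - 1"
      using hook_length_remove_corner[OF c, of m y] down[OF mk(1), of m y] mk by (auto simp: E_def)
    then show "r (m, y) = 1 + 1 / (real (hook_length D (m, y)) - 1)"
      using y hook_gt_1_col[OF c, of y] by (auto simp: r_def of_nat_diff field_simps)
  qed
  finally show ?thesis unfolding sum_walk_weight[OF c] E_def .
qed

text \<open>Double counting: each box has total weight 1 over the corners, and each corner collects
  its ratio over the boxes.\<close>

lemma card_eq_sum_hook_prod_ratio:
  "real (card D) = (\<Sum>c\<in>corners. real (hook_prod D D) / real (hook_prod (D - {c}) (D - {c})))"
proof -
  have "real (card D) = (\<Sum>u\<in>D. \<Sum>(m, k)\<in>corners. walk_weight m k u)"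
    by (simp add: sum_walk_weight_corners)
  also have "\<dots> = (\<Sum>(m, k)\<in>corners. \<Sum>u\<in>D. walk_weight m k u)"
    by (subst sum.swap) (simp add: case_prod_unfold)
  also have "\<dots> = (\<Sum>c\<in>corners. real (hook_prod D D) / real (hook_prod (D - {c}) (D - {c})))"
    by (rule sum.cong) (auto simp: hook_prod_remove_corner)
  finally show ?thesis .
qed

section \<open>Standard tableaux and the position of the largest entry\<close>

lemma add_corner_tableau:
  assumes c: "c \<in> corners" and T: "T \<in> standard_tableaux (D - {c})"
  shows "T(c := card D) \<in> standard_tableaux D"
proof -
  obtain m k where mk: "c = (m, k)" by fastforce
  have cD: "c \<in> D" using c by (auto simp: corners_def)
  then have n: "card D = Suc (card (D - {c}))" by (rule card.remove[OF finite_D])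
  have bij: "bij_betw T (D - {c}) {1..card (D - {c})}" using T by (simp add: standard_tableaux_def)
  have lt: "T u < card D" if "u \<in> D" "u \<noteq> c" for u
    using bij_betwE[OF bij, rule_format, of u] that n by simp
  have "bij_betw (T(c := card D)) (D - {c}) {1..card (D - {c})}"
    using bij by (rule bij_betw_cong[THEN iffD1, rotated]) simp
  moreover have "card D \<notin> {1..card (D - {c})}" using n by simp
  ultimately have "bij_betw (T(c := card D)) (D - {c} \<union> {c}) ({1..card (D - {c})} \<union> {(T(c := card D)) c})"
    by (intro notIn_Un_bij_betw) simp_all
  moreover have "D - {c} \<union> {c} = D" using cD by blast
  moreover have "{1..card (D - {c})} \<union> {card D} = {1..card D}" unfolding n by auto
  ultimately have "bij_betw (T(c := card D)) D {1..card D}" by simp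
  moreover have "T(c := card D) \<in> extensional D"
    using T cD by (auto simp: standard_tableaux_def extensional_def)
  \<comment> \<open>With no box to the right of or above the corner, the largest entry can violate
    no inequality.\<close>
  moreover have "(x, k) \<notin> D" if "m < x" for x
    using cornerD[of m k] c mk mem_iff_row[of x k] that by auto
  moreover have "(m, y) \<notin> D" if "k < y" for y
    using cornerD[of m k] c mk mem_iff_col[of m y] that by auto
  ultimately show ?thesis
    using T lt mk by (auto simp: standard_tableaux_def)
qed

text \<open>A right or upper neighbour of the largest entry would have to hold a still larger
  one.\<close>

lemma remove_corner_tableau:
  assumes T: "T \<in> standard_tableaux D" and c: "c \<in> D" "T c = card D"
  shows "c \<in> corners" "restrict T (D - {c}) \<in> standard_tableaux (D - {c})"
    "T = (restrict T (D - {c}))(c := card D)"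
proof -
  have bij: "bij_betw T D {1..card D}" and ext: "T \<in> extensional D"
    using T by (auto simp: standard_tableaux_def)
  have le: "T u \<le> card D" if "u \<in> D" for u using bij_betwE[OF bij] that by auto
  obtain m k where mk: "c = (m, k)" by fastforce
  have inc: "\<forall>x x' y. (x, y) \<in> D \<longrightarrow> (x', y) \<in> D \<longrightarrow> x < x' \<longrightarrow> T (x, y) < T (x', y)"
    "\<forall>x y y'. (x, y) \<in> D \<longrightarrow> (x, y') \<in> D \<longrightarrow> y < y' \<longrightarrow> T (x, y) < T (x, y')"
    using T unfolding standard_tableaux_def by blast+
  have "T (m, k) < T (m + 1, k)" if "(m + 1, k) \<in> D"
    using inc(1)[rule_format, of m k "m + 1"] that c mk by simp
  moreover have "T (m, k) < T (m, k + 1)" if "(m, k + 1) \<in> D"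
    using inc(2)[rule_format, of m k "k + 1"] that c mk by simp
  ultimately show "c \<in> corners"
    using c mk le[of "(m + 1, k)"] le[of "(m, k + 1)"] by (auto simp: corners_def)
  have "bij_betw T (D - {c}) ({1..card D} - {T c})"
    by (rule bij_betw_DiffI[OF bij]) (use c bij_betwE[OF bij] in auto)
  moreover have "{1..card D} - {T c} = {1..card (D - {c})}"
    using card.remove[OF finite_D c(1)] c(2) by auto
  ultimately have "bij_betw (restrict T (D - {c})) (D - {c}) {1..card (D - {c})}"
    using bij_betw_cong[of "D - {c}" "restrict T (D - {c})" T] by (simp only: restrict_apply' simp_thms)
  then show "restrict T (D - {c}) \<in> standard_tableaux (D - {c})"
    using T by (auto simp: standard_tableaux_def)
  show "T = (restrict T (D - {c}))(c := card D)"
    using ext c by (auto simp: fun_eq_iff extensional_def)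
qed

text \<open>Tableaux are classified by the corner that holds the largest entry.\<close>

lemma num_syt_eq_sum_corners:
  assumes "D \<noteq> {}"
  shows "num_syt D = (\<Sum>c\<in>corners. num_syt (D - {c}))"
proof -
  let ?S = "\<lambda>c. (\<lambda>T. T(c := card D)) ` standard_tableaux (D - {c})"
  have un: "standard_tableaux D = (\<Union>c\<in>corners. ?S c)"
  proof (intro equalityI subsetI)
    fix T assume T: "T \<in> standard_tableaux D"
    have "card D \<in> {1..card D}" using assms finite_D by (simp add: card_gt_0_iff Suc_le_eq)
    also have "{1..card D} = T ` D" using T by (simp add: standard_tableaux_def bij_betw_def)
    finally obtain c where "c \<in> D" "T c = card D" by (auto elim!: imageE)
    from remove_corner_tableau[OF T this] show "T \<in> (\<Union>c\<in>corners. ?S c)" by blast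
  qed (use add_corner_tableau in blast)
  have "card (\<Union>c\<in>corners. ?S c) = (\<Sum>c\<in>corners. card (?S c))"
  proof (rule card_UN_disjoint)
    show "\<forall>i\<in>corners. \<forall>j\<in>corners. i \<noteq> j \<longrightarrow> ?S i \<inter> ?S j = {}"
    proof (intro ballI impI equals0I)
      fix i j T assume ij: "i \<in> corners" "j \<in> corners" "i \<noteq> j" and "T \<in> ?S i \<inter> ?S j"
      \<comment> \<open>A common tableau would have \<open>card D\<close> in box \<open>j\<close>
        already before box \<open>i\<close> is filled, but the entries of \<open>U\<close> stop at
        \<open>card D - 1\<close>.\<close>
      then obtain U where U: "U \<in> standard_tableaux (D - {i})" "U j = card D"
        using fun_upd_other fun_upd_same by (smt (verit) IntE imageE)
      have D: "i \<in> D" "j \<in> D" using ij by (auto simp: corners_def)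
      have "U j \<in> {1..card (D - {i})}"
        using U(1) D ij by (auto simp: standard_tableaux_def dest!: bij_betwE)
      then show False using U ij card.remove[OF finite_D D(1)] by simp
    qed
  qed (use finite_corners finite_D finite_standard_tableaux in auto)
  moreover have "card (?S c) = num_syt (D - {c})" for c
    unfolding num_syt_def
  proof (rule card_image, rule inj_onI)
    fix T U assume h: "T \<in> standard_tableaux (D - {c})" "U \<in> standard_tableaux (D - {c})"
      "T(c := card D) = U(c := card D)"
    then have "T \<in> extensional (D - {c})" "U \<in> extensional (D - {c})"
      by (simp_all add: standard_tableaux_def)
    \<comment> \<open>Both fillings are \<open>undefined\<close> at \<open>c\<close>, so the update
      destroys no information.\<close>
    then have "T c = U c" using extensional_arb[of T "D - {c}" c] extensional_arb[of U "D - {c}" c] by simp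
    moreover have "(T(c := card D))(c := T c) = (U(c := card D))(c := T c)" unfolding h(3) ..
    ultimately show "T = U" by (metis fun_upd_triv fun_upd_upd)
  qed
  ultimately show ?thesis unfolding num_syt_def[of D] un by simp
qed

end

theorem hook_length_formula:
  assumes "young p q D"
  shows "real (num_syt D) * real (hook_prod D D) = fact (card D)"
  using assms
proof (induction "card D" arbitrary: D rule: less_induct)
  case less
  then interpret young p q D by simp
  show ?case
  proof (cases "D = {}")
    case True
    have "standard_tableaux {} = {\<lambda>_. undefined}"
      by (auto simp: standard_tableaux_def bij_betw_def)
    then show ?thesis by (simp add: True num_syt_def hook_prod_def)
  next
    case False
    then have pos: "card D > 0" using finite_D by (simp add: card_gt_0_iff)
    \<comment> \<open>The induction hypothesis for the diagram without \<open>c\<close>, solved for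
      the number of tableaux.\<close>
    have step: "real (num_syt (D - {c})) = fact (card D - 1) / real (hook_prod (D - {c}) (D - {c}))"
      if c: "c \<in> corners" for c
    proof -
      interpret E: young p q "D - {c}" by (rule young_remove_corner[OF c])
      have "c \<in> D" using c by (auto simp: corners_def)
      then have "card (D - {c}) = card D - 1" "card (D - {c}) < card D" using finite_D pos by auto
      then have "real (num_syt (D - {c})) * real (hook_prod (D - {c}) (D - {c})) = fact (card D - 1)"
        using less.hyps[OF _ E.young_axioms] by simp
      moreover have "hook_prod (D - {c}) (D - {c}) > 0"
        unfolding hook_prod_def by (rule prod_pos) (use E.hook_length_pos in blast)
      ultimately show ?thesis by (simp add: field_simps)
    qed
    have "real (num_syt D) * real (hook_prod D D)
        = (\<Sum>c\<in>corners. fact (card D - 1) * (real (hook_prod D D) / real (hook_prod (D - {c}) (D - {c}))))"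
      unfolding num_syt_eq_sum_corners[OF False] of_nat_sum sum_distrib_right
      by (rule sum.cong) (simp_all add: step)
    also have "\<dots> = fact (card D - 1) * real (card D)"
      unfolding card_eq_sum_hook_prod_ratio sum_distrib_left ..
    finally show ?thesis using pos by (simp add: fact_reduce)
  qed
qed

subsection \<open>A product bound\<close>

text \<open>The quadratic Taylor bound is taken at \<open>y / 2\<close> and squared; taken at
  \<open>y\<close> it would suffice only up to y = 2.\<close>

lemma one_plus_square_le_exp:
  fixes y :: real
  assumes "0 \<le> y"
  shows "1 + y\<^sup>2 \<le> exp y"
proof -
  have "(1 + y/2 + (y/2)\<^sup>2 / 2)\<^sup>2 \<le> (exp (y/2))\<^sup>2"
    using exp_lower_Taylor_quadratic[of "y/2"] assms by (intro power_mono) auto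
  also have "(exp (y/2))\<^sup>2 = exp y" by (simp flip: exp_double)
  moreover have "(1 + y/2 + (y/2)\<^sup>2 / 2)\<^sup>2 = 1 + y\<^sup>2 + y * ((y/2 - 1)\<^sup>2 / 2 + 1/2) + (y\<^sup>2)\<^sup>2 / 64"
    by (simp add: power2_eq_square field_simps)
  moreover have "0 \<le> y * ((y/2 - 1)\<^sup>2 / 2 + 1/2) + (y\<^sup>2)\<^sup>2 / 64" using assms by simp
  ultimately show ?thesis by linarith
qed

text \<open>Each term is at most twice the difference of consecutive square roots: for v^2 = u^2 + 1
  one has 2 v (v - u) = 1 + (v - u)^2.\<close>

lemma sum_inverse_sqrt_le: "(\<Sum>i=0..<k. 1 / sqrt (real i + 1)) \<le> 2 * sqrt (real k)"
proof (induction k)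
  case (Suc k)
  define u v where "u = sqrt (real k)" and "v = sqrt (real k + 1)"
  have uv: "0 \<le> u" "0 < v" "v\<^sup>2 = u\<^sup>2 + 1" by (auto simp: u_def v_def)
  have "0 \<le> (v - u)\<^sup>2" by simp
  then have "1 \<le> (2 * v - 2 * u) * v"
    using uv by (simp add: power2_eq_square algebra_simps)
  then have "1 / v \<le> 2 * v - 2 * u" using uv by (simp add: divide_le_eq)
  then show ?case using Suc by (simp add: u_def v_def add.commute)
qed simp

lemma prod_one_plus_ratio_le_exp:
  fixes g :: "nat \<Rightarrow> real"
  assumes nonneg: "\<And>i. i < k \<Longrightarrow> 0 \<le> g i" and mono: "\<And>i j. i \<le> j \<Longrightarrow> j < k \<Longrightarrow> g i \<le> g j"
  shows "(\<Prod>i=0..<k. 1 + g i / (real i + 1)) \<le> exp (2 * sqrt (\<Sum>i=0..<k. g i))"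
proof -
  define G where "G = (\<Sum>i=0..<k. g i)"
  define S where "S = (\<Sum>i=0..<k. sqrt (g i))"
  define t where "t = (\<Sum>i=0..<k. sqrt (g i) * (1 / sqrt (real i + 1)))"
  have G: "0 \<le> G" unfolding G_def by (rule sum_nonneg) (use nonneg in auto)
  have "(\<Prod>i=0..<k. 1 + g i / (real i + 1)) \<le> (\<Prod>i=0..<k. exp (sqrt (g i) * (1 / sqrt (real i + 1))))"
  proof (intro prod_mono conjI)
    fix i assume "i \<in> {0..<k}"
    then have g: "0 \<le> g i" using nonneg by simp
    then show "0 \<le> 1 + g i / (real i + 1)" by simp
    show "1 + g i / (real i + 1) \<le> exp (sqrt (g i) * (1 / sqrt (real i + 1)))"
      using one_plus_square_le_exp[of "sqrt (g i) * (1 / sqrt (real i + 1))"] g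
      by (simp add: power_mult_distrib power_divide)
  qed
  also have "\<dots> = exp t" unfolding t_def by (rule exp_sum[symmetric]) simp
  finally have "(\<Prod>i=0..<k. 1 + g i / (real i + 1)) \<le> exp t" .
  moreover have "t \<le> 2 * sqrt G"
  proof (cases "k = 0")
    case False
    \<comment> \<open>Chebyshev applies because \<open>sqrt (g i)\<close> increases with
      \<open>i\<close> while \<open>1 / sqrt (real i + 1)\<close> decreases.\<close>
    have "real k * t \<le> S * (\<Sum>i=0..<k. 1 / sqrt (real i + 1))"
      unfolding t_def S_def
      by (rule Chebyshev_sum_upper) (use mono in \<open>auto intro!: divide_left_mono\<close>)
    also have "\<dots> \<le> S * (2 * sqrt (real k))"
      using sum_inverse_sqrt_le[of k] nonneg by (intro mult_left_mono) (auto simp: S_def intro!: sum_nonneg)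
    also have "S \<le> sqrt (real k * G)"
    proof (rule real_le_rsqrt)
      \<comment> \<open>This Cauchy-Schwarz bound is Chebyshev's inequality for the increasing
        \<open>sqrt (g i)\<close> and its decreasing negative.\<close>
      have "real k * (\<Sum>i=0..<k. sqrt (g i) * - sqrt (g i)) \<le> S * (\<Sum>i=0..<k. - sqrt (g i))"
        unfolding S_def by (rule Chebyshev_sum_upper) (use mono in auto)
      moreover have "(\<Sum>i=0..<k. sqrt (g i) * sqrt (g i)) = G"
        unfolding G_def by (rule sum.cong) (use nonneg in auto)
      ultimately show "S\<^sup>2 \<le> real k * G"
        by (simp add: sum_negf S_def power2_eq_square)
    qed
    then have "S * (2 * sqrt (real k)) \<le> sqrt (real k * G) * (2 * sqrt (real k))"
      by (rule mult_right_mono) simp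
    also have "\<dots> = real k * (2 * sqrt G)" by (simp add: real_sqrt_mult)
    finally show ?thesis using False by simp
  qed (use G in \<open>simp add: t_def\<close>)
  ultimately show ?thesis unfolding G_def using exp_le_cancel_iff order_trans by blast
qed

subsection \<open>External hook and center\<close>

lemma hook_length_swap: "hook_length (prod.swap ` S) (prod.swap u) = hook_length S u"
proof -
  have "{v \<in> prod.swap ` S. (fst v = snd u \<and> snd v \<ge> fst u) \<or> (snd v = fst u \<and> fst v \<ge> snd u)}
    = prod.swap ` {v \<in> S. (fst v = fst u \<and> snd v \<ge> snd u) \<or> (snd v = snd u \<and> fst v \<ge> fst u)}"
    by force
  then show ?thesis
    unfolding hook_length_def fst_swap snd_swap by (simp add: card_image)
qed

text \<open>With \<open>trunc_row_swap\<close> and \<open>center_swap\<close>, this transfers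
  results on the truncated row to the truncated column.\<close>

lemma hook_prod_swap: "hook_prod (prod.swap ` S) (prod.swap ` E) = hook_prod S E"
  unfolding hook_prod_def by (simp add: prod.reindex hook_length_swap)

lemma young_swap:
  assumes "young p q D"
  shows "young q p (prod.swap ` D)"
proof -
  interpret young p q D by fact
  show ?thesis
  proof
    show "finite (prod.swap ` D)" using finite_D by simp
    show "q \<le> x \<and> p \<le> y" if "(x, y) \<in> prod.swap ` D" for x y
      using that base[of y x] by auto
    show "(x', y') \<in> prod.swap ` D"
      if "(x, y) \<in> prod.swap ` D" "q \<le> x'" "x' \<le> x" "p \<le> y'" "y' \<le> y" for x y x' y'
      using that down[of y x y' x'] by auto
  qed
qed

lemma trunc_row_swap: "trunc_row (prod.swap ` D) = prod.swap ` trunc_column D"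
  by (force simp: trunc_row_def trunc_column_def first_row_def first_column_def)

lemma center_swap: "center (prod.swap ` D) = prod.swap ` center D"
  by (force simp: center_def external_hook_def first_row_def first_column_def)

lemma mem_trunc_row: "u \<in> trunc_row D \<longleftrightarrow> u \<in> D \<and> snd u = 1 \<and> fst u \<noteq> 1"
  by (auto simp: trunc_row_def first_row_def prod_eq_iff)

lemma mem_trunc_column: "u \<in> trunc_column D \<longleftrightarrow> u \<in> D \<and> fst u = 1 \<and> snd u \<noteq> 1"
  by (auto simp: trunc_column_def first_column_def prod_eq_iff)

lemma mem_center: "u \<in> center D \<longleftrightarrow> u \<in> D \<and> fst u \<noteq> 1 \<and> snd u \<noteq> 1"
  by (auto simp: center_def external_hook_def first_row_def first_column_def)

lemma mem_external_hook: "u \<in> external_hook D \<longleftrightarrow> u \<in> D \<and> (fst u = 1 \<or> snd u = 1)"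
  by (auto simp: external_hook_def first_row_def first_column_def)

text \<open>With the next three identities, this allows the factorization to be applied to the
  external hook as a diagram of its own.\<close>

lemma trunc_row_external_hook: "trunc_row (external_hook D) = trunc_row D"
  by (auto simp: mem_trunc_row mem_external_hook)

lemma trunc_column_external_hook: "trunc_column (external_hook D) = trunc_column D"
  by (auto simp: mem_trunc_column mem_external_hook)

lemma external_hook_external_hook: "external_hook (external_hook D) = external_hook D"
  by (auto simp: mem_external_hook)

lemma center_external_hook: "center (external_hook D) = {}"
  by (auto simp: mem_center mem_external_hook)

section \<open>Decomposition of a diagram\<close>

locale young_diagram = young 1 1 D for D +
  assumes nonempty: "D \<noteq> {}"
begin

lemma corner_box_mem: "(1, 1) \<in> D"
proof -
  obtain x y where "(x, y) \<in> D" using nonempty by auto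
  then show ?thesis using base down by blast
qed

lemma trunc_row_eq: "trunc_row D = (\<lambda>x. (x, 1)) ` {2..row_end 1}"
  by (auto simp: mem_trunc_row mem_iff_row image_iff)

lemma finite_parts: "finite (trunc_row D)" "finite (trunc_column D)" "finite (center D)"
  using finite_D by (simp_all add: trunc_row_def first_row_def trunc_column_def first_column_def center_def)

lemma D_decomp: "D = insert (1, 1) (trunc_row D \<union> (trunc_column D \<union> center D))"
  using corner_box_mem by (auto simp: mem_trunc_row mem_trunc_column mem_center)

lemma external_hook_decomp: "external_hook D = insert (1, 1) (trunc_row D \<union> trunc_column D)"
  using corner_box_mem by (auto simp: mem_trunc_row mem_trunc_column mem_external_hook)

lemma card_external_hook: "card (external_hook D) = card (trunc_row D) + card (trunc_column D) + 1"
proof -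
  have "(1, 1) \<notin> trunc_row D \<union> trunc_column D" "trunc_row D \<inter> trunc_column D = {}"
    by (auto simp: mem_trunc_row mem_trunc_column)
  then show ?thesis unfolding external_hook_decomp using finite_parts
    by (simp add: card_Un_disjoint)
qed

lemma card_D: "card D = card (external_hook D) + card (center D)"
proof -
  have "external_hook D \<subseteq> D" by (auto simp: mem_external_hook)
  then show ?thesis
    unfolding center_def using finite_D by (simp add: card_Diff_subset finite_subset card_mono)
qed

lemma hook_length_corner_box: "hook_length D (1, 1) = card (external_hook D)"
proof -
  have "{v \<in> D. (fst v = 1 \<and> snd v \<ge> 1) \<or> (snd v = 1 \<and> fst v \<ge> 1)} = external_hook D"
    using base by (auto simp: mem_external_hook)
  then show ?thesis by (simp add: hook_length_def)
qed

text \<open>Hooks run right and up, hence away from the first row and the first column.\<close>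

lemma hook_prod_center: "hook_prod D (center D) = hook_prod (center D) (center D)"
  unfolding hook_prod_def
proof (rule prod.cong[OF refl])
  fix u assume "u \<in> center D"
  then have "{v \<in> D. (fst v = fst u \<and> snd v \<ge> snd u) \<or> (snd v = snd u \<and> fst v \<ge> fst u)}
    = {v \<in> center D. (fst v = fst u \<and> snd v \<ge> snd u) \<or> (snd v = snd u \<and> fst v \<ge> fst u)}"
    using base[of "fst u" "snd u"] by (auto simp: mem_center)
  then show "hook_length D u = hook_length (center D) u" by (simp add: hook_length_def)
qed

lemma hook_prod_decomp:
  "hook_prod D D = card (external_hook D) * hook_prod D (trunc_row D) * hook_prod D (trunc_column D)
    * hook_prod (center D) (center D)"
proof -
  have "hook_prod D D = hook_prod D (insert (1, 1) (trunc_row D \<union> (trunc_column D \<union> center D)))"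
    using D_decomp by simp
  also have "\<dots> = hook_length D (1, 1) * (hook_prod D (trunc_row D) * (hook_prod D (trunc_column D)
      * hook_prod D (center D)))"
    unfolding hook_prod_def using finite_parts
    by (subst prod.insert prod.union_disjoint; (force simp: mem_trunc_row mem_trunc_column mem_center)?)+
  finally show ?thesis by (simp add: hook_prod_center hook_length_corner_box mult.assoc)
qed

lemma young_center: "young 2 2 (center D)"
proof
  show "finite (center D)" by (rule finite_parts)
  show "2 \<le> x \<and> 2 \<le> y" if "(x, y) \<in> center D" for x y
    using that base[of x y] by (auto simp: mem_center)
  show "(x', y') \<in> center D"
    if "(x, y) \<in> center D" "2 \<le> x'" "x' \<le> x" "2 \<le> y'" "y' \<le> y" for x y x' y'
    using that down[of x y x' y'] by (auto simp: mem_center)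
qed

lemma young_diagram_external_hook: "young_diagram (external_hook D)"
proof
  show "finite (external_hook D)" using finite_D by (simp add: external_hook_def first_row_def first_column_def)
  show "external_hook D \<noteq> {}" by (simp add: external_hook_decomp)
  show "1 \<le> x \<and> 1 \<le> y" if "(x, y) \<in> external_hook D" for x y
    using that base[of x y] by (auto simp: mem_external_hook)
  show "(x', y') \<in> external_hook D"
    if "(x, y) \<in> external_hook D" "1 \<le> x'" "x' \<le> x" "1 \<le> y'" "y' \<le> y" for x y x' y'
    using that down[of x y x' y'] by (auto simp: mem_external_hook)
qed

section \<open>Hooks based in the truncated row and column\<close>

lemma hook_length_trunc_row:
  assumes "x \<in> {2..row_end 1}"
  shows "hook_length (trunc_row D) (x, 1) = nat (row_end 1 - x + 1)"
proof -
  have "{v \<in> trunc_row D. (fst v = x \<and> snd v \<ge> 1) \<or> (snd v = 1 \<and> fst v \<ge> x)} = (\<lambda>x. (x, 1)) ` {x..row_end 1}"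
    using assms by (auto simp: trunc_row_eq)
  then show ?thesis by (simp add: hook_length_def card_image inj_on_def)
qed

text \<open>Numbering from the right end gives box \<open>i\<close> an arm of length
  \<open>i\<close> and makes the column heights increase with \<open>i\<close>, as Chebyshev's
  inequality requires.\<close>

lemma prod_trunc_row:
  "(\<Prod>u\<in>trunc_row D. f u) = (\<Prod>i=0..<card (trunc_row D). f (row_end 1 - int i, 1))"
proof -
  have "card (trunc_row D) = nat (row_end 1 - 1)" by (simp add: trunc_row_eq card_image inj_on_def)
  then show ?thesis unfolding trunc_row_eq
    by (intro prod.reindex_bij_witness[of _ "\<lambda>i. (row_end 1 - int i, 1)" "\<lambda>u. nat (row_end 1 - fst u)"]) auto
qed

lemma hook_prod_trunc_row: "hook_prod (trunc_row D) (trunc_row D) = fact (card (trunc_row D))"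
proof -
  have card: "card (trunc_row D) = nat (row_end 1 - 1)" by (simp add: trunc_row_eq card_image inj_on_def)
  have "hook_prod (trunc_row D) (trunc_row D) = (\<Prod>i=0..<card (trunc_row D). Suc i)"
    unfolding hook_prod_def prod_trunc_row
    by (rule prod.cong) (auto simp: card hook_length_trunc_row)
  then show ?thesis by (simp add: fact_prod_Suc)
qed

lemma card_center: "int (card (center D)) = (\<Sum>x\<in>{2..row_end 1}. col_end x - 1)"
proof -
  have pos: "1 \<le> col_end x" if "x \<in> {2..row_end 1}" for x
    using that mem_iff_row[of x 1] mem_iff_col[of x 1] by auto
  \<comment> \<open>The center column by column; the bottom box of each column lies in the first
    row, which explains the summand \<open>col_end x - 1\<close>.\<close>
  have "center D = (SIGMA x:{2..row_end 1}. {2..col_end x})"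
  proof -
    have "x \<le> row_end 1" if "(x, y) \<in> D" for x y
      using that base[OF that] down[OF that, of x 1] mem_iff_row[of x 1] by auto
    then have "(x, y) \<in> D \<and> x \<noteq> 1 \<and> y \<noteq> 1 \<longleftrightarrow> 2 \<le> x \<and> x \<le> row_end 1 \<and> 2 \<le> y \<and> y \<le> col_end x" for x y
      using base[of x y] mem_iff_col[of x y] by fastforce
    then show ?thesis unfolding set_eq_iff mem_center split_paired_All by simp
  qed
  then have "int (card (center D)) = (\<Sum>x\<in>{2..row_end 1}. int (nat (col_end x - 1)))"
    by (simp add: card_SigmaI)
  also have "\<dots> = (\<Sum>x\<in>{2..row_end 1}. col_end x - 1)"
  proof (rule sum.cong[OF refl])
    show "int (nat (col_end x - 1)) = col_end x - 1" if "x \<in> {2..row_end 1}" for x using pos[OF that] by simp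
  qed
  finally show ?thesis .
qed

text \<open>Column \<open>x'\<close> is non-empty, and its top box forces the box of column
  \<open>x\<close> at the same height into \<open>D\<close>.\<close>

lemma col_end_antimono: "1 \<le> x \<Longrightarrow> x \<le> x' \<Longrightarrow> x' \<le> row_end 1 \<Longrightarrow> col_end x' \<le> col_end x"
  using mem_iff_row[of x' 1] mem_iff_col[of x' 1] mem_iff_col[of x' "col_end x'"] mem_iff_col[of x "col_end x'"] down[of x' "col_end x'" x "col_end x'"]
  by auto

lemma hook_prod_row_le:
  "real (hook_prod D (trunc_row D))
    \<le> exp (2 * sqrt (real (card (center D)))) * real (hook_prod (trunc_row D) (trunc_row D))"
proof -
  define k where "k = card (trunc_row D)"
  have k: "k = nat (row_end 1 - 1)" by (simp add: k_def trunc_row_eq card_image inj_on_def)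
  \<comment> \<open>\<open>g i\<close> is the height of a column of the center, which is also the
    leg of box \<open>i\<close> of the first row.\<close>
  define g where "g i = real_of_int (col_end (row_end 1 - int i) - 1)" for i
  have mem: "(row_end 1 - int i, 1) \<in> D" if "i < k" for i
    using that k mem_iff_row[of "row_end 1 - int i" 1] by simp
  have "real (hook_prod D (trunc_row D)) = (\<Prod>i=0..<k. (1 + g i / (real i + 1)) * (real i + 1))"
    unfolding hook_prod_def prod_trunc_row k_def[symmetric] of_nat_prod
  proof (rule prod.cong[OF refl])
    fix i assume "i \<in> {0..<k}"
    then have "int (hook_length D (row_end 1 - int i, 1)) = int i + 1 + (col_end (row_end 1 - int i) - 1)"
      using hook_length_eq[OF mem[of i]] by simp
    then have "real (hook_length D (row_end 1 - int i, 1)) = real i + 1 + g i"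
      unfolding g_def by (metis of_int_add of_int_of_nat_eq of_int_1)
    then show "real (hook_length D (row_end 1 - int i, 1)) = (1 + g i / (real i + 1)) * (real i + 1)"
      by (simp add: field_simps)
  qed
  also have "\<dots> = (\<Prod>i=0..<k. 1 + g i / (real i + 1)) * real (hook_prod (trunc_row D) (trunc_row D))"
    unfolding hook_prod_trunc_row k_def[symmetric] fact_prod_Suc
    by (simp add: prod.distrib add.commute)
  also have "(\<Prod>i=0..<k. 1 + g i / (real i + 1)) \<le> exp (2 * sqrt (\<Sum>i=0..<k. g i))"
  proof (rule prod_one_plus_ratio_le_exp)
    show "0 \<le> g i" if "i < k" for i
      using mem[OF that] mem_iff_col[of "row_end 1 - int i" 1] by (simp add: g_def)
    show "g i \<le> g j" if "i \<le> j" "j < k" for i j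
      using col_end_antimono[of "row_end 1 - int j" "row_end 1 - int i"] that k by (simp add: g_def)
  qed
  also have "(\<Sum>i=0..<k. g i) = real_of_int (\<Sum>x\<in>{2..row_end 1}. col_end x - 1)"
    unfolding g_def of_int_sum k
    by (rule sum.reindex_bij_witness[of _ "\<lambda>x. nat (row_end 1 - x)" "\<lambda>i. row_end 1 - int i"]) auto
  also have "\<dots> = real (card (center D))" by (simp flip: card_center)
  finally show ?thesis by (simp add: mult_right_mono)
qed

lemma young_diagram_swap: "young_diagram (prod.swap ` D)"
  using young_swap[OF young_axioms] nonempty
  by (simp add: young_diagram_def young_diagram_axioms_def)

lemma hook_prod_trunc_column: "hook_prod (trunc_column D) (trunc_column D) = fact (card (trunc_column D))"
proof -
  interpret tr: young_diagram "prod.swap ` D" by (rule young_diagram_swap)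
  show ?thesis using tr.hook_prod_trunc_row by (simp add: trunc_row_swap hook_prod_swap card_image)
qed

lemma hook_prod_column_le:
  "real (hook_prod D (trunc_column D))
    \<le> exp (2 * sqrt (real (card (center D)))) * real (hook_prod (trunc_column D) (trunc_column D))"
proof -
  interpret tr: young_diagram "prod.swap ` D" by (rule young_diagram_swap)
  show ?thesis using tr.hook_prod_row_le
    by (simp add: trunc_row_swap center_swap hook_prod_swap card_image)
qed

text \<open>The external hook is a diagram with empty center, and inside it the hook of a box of the
  truncated row or column never leaves that row or column.\<close>

lemma hook_prod_external_hook:
  "hook_prod (external_hook D) (external_hook D)
    = card (external_hook D) * fact (card (trunc_row D)) * fact (card (trunc_column D))"
proof -
  interpret s: young_diagram "external_hook D" by (rule young_diagram_external_hook)
  have row: "hook_length (external_hook D) u = hook_length (trunc_row D) u" if "u \<in> trunc_row D" for u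
  proof -
    obtain x y where "u = (x, y)" by fastforce
    then show ?thesis unfolding hook_length_def
      using that base[of x y] by (intro arg_cong[of _ _ card]) (auto simp: mem_trunc_row mem_external_hook)
  qed
  have column: "hook_length (external_hook D) u = hook_length (trunc_column D) u" if "u \<in> trunc_column D" for u
  proof -
    obtain x y where "u = (x, y)" by fastforce
    then show ?thesis unfolding hook_length_def
      using that base[of x y] by (intro arg_cong[of _ _ card]) (auto simp: mem_trunc_column mem_external_hook)
  qed
  have "hook_prod (external_hook D) (trunc_row D) = fact (card (trunc_row D))"
    unfolding hook_prod_trunc_row[symmetric] hook_prod_def by (rule prod.cong[OF refl row])
  moreover have "hook_prod (external_hook D) (trunc_column D) = fact (card (trunc_column D))"
    unfolding hook_prod_trunc_column[symmetric] hook_prod_def by (rule prod.cong[OF refl column])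
  moreover have "hook_prod {} {} = 1" by (simp add: hook_prod_def)
  ultimately show ?thesis
    using s.hook_prod_decomp
    by (simp add: trunc_row_external_hook trunc_column_external_hook external_hook_external_hook
        center_external_hook)
qed

section \<open>Identities and lower bound\<close>

lemma hook_prod_pos: "E \<subseteq> D \<Longrightarrow> hook_prod D E > 0"
  unfolding hook_prod_def by (rule prod_pos) (use hook_length_pos in blast)

text \<open>Since |s| - 1 = |a| + |b|, the quotient of |s|! by the binomial is |s| |a|! |b|!, and
  the factorials cancel against H(a,a) and H(b,b).\<close>

lemma hook_prod_eq:
  "real (hook_prod D D) =
     fact (card (external_hook D)) / real ((card (external_hook D) - 1) choose card (trunc_column D))
     * (real (hook_prod D (trunc_row D)) / real (hook_prod (trunc_row D) (trunc_row D)))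
     * (real (hook_prod D (trunc_column D)) / real (hook_prod (trunc_column D) (trunc_column D)))
     * real (hook_prod (center D) (center D))"
proof -
  have "real ((card (external_hook D) - 1) choose card (trunc_column D))
      = fact (card (trunc_row D) + card (trunc_column D)) / (fact (card (trunc_column D)) * fact (card (trunc_row D)))"
    unfolding card_external_hook by (simp add: binomial_fact)
  moreover have "fact (card (external_hook D)) = real (card (external_hook D)) * fact (card (trunc_row D) + card (trunc_column D))"
    unfolding card_external_hook by simp
  ultimately show ?thesis
    unfolding hook_prod_decomp hook_prod_trunc_row hook_prod_trunc_column by simp
qed

lemma num_syt_ratio_eq:
  "real (num_syt D) / (real (card D choose card (center D)) * real (num_syt (external_hook D)) * real (num_syt (center D)))
    = (real (hook_prod (trunc_row D) (trunc_row D)) / real (hook_prod D (trunc_row D)))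
      * (real (hook_prod (trunc_column D) (trunc_column D)) / real (hook_prod D (trunc_column D)))"
proof -
  interpret s: young_diagram "external_hook D" by (rule young_diagram_external_hook)
  interpret c: young 2 2 "center D" by (rule young_center)
  have pos: "hook_prod D D > 0" "hook_prod (external_hook D) (external_hook D) > 0"
    "hook_prod (center D) (center D) > 0" "hook_prod D (trunc_row D) > 0" "hook_prod D (trunc_column D) > 0"
    unfolding hook_prod_def
    by (rule prod_pos; use hook_length_pos s.hook_length_pos c.hook_length_pos in
        \<open>force simp: mem_trunc_row mem_trunc_column\<close>)+
  have s_pos: "card (external_hook D) > 0" by (simp add: card_external_hook)
  have syt: "real (num_syt D) = fact (card D) / real (hook_prod D D)"
    "real (num_syt (external_hook D)) = fact (card (external_hook D)) / real (hook_prod (external_hook D) (external_hook D))"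
    "real (num_syt (center D)) = fact (card (center D)) / real (hook_prod (center D) (center D))"
    using hook_length_formula[OF young_axioms] hook_length_formula[OF s.young_axioms]
      hook_length_formula[OF young_center] pos by (simp_all add: field_simps)
  have "real (card D choose card (center D)) = fact (card D) / (fact (card (center D)) * fact (card (external_hook D)))"
    by (simp add: binomial_fact card_D)
  \<comment> \<open>The factorials from the three hook length formulas cancel against the binomial
    coefficient.\<close>
  then have "real (num_syt D) / (real (card D choose card (center D)) * real (num_syt (external_hook D)) * real (num_syt (center D)))
      = real (hook_prod (external_hook D) (external_hook D)) * real (hook_prod (center D) (center D)) / real (hook_prod D D)"
    unfolding syt using pos by (simp add: field_simps)
  also have "\<dots> = (real (hook_prod (trunc_row D) (trunc_row D)) / real (hook_prod D (trunc_row D)))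
      * (real (hook_prod (trunc_column D) (trunc_column D)) / real (hook_prod D (trunc_column D)))"
    unfolding hook_prod_decomp hook_prod_external_hook hook_prod_trunc_row hook_prod_trunc_column
    using pos s_pos by (simp add: field_simps)
  finally show ?thesis .
qed

lemma num_syt_ratio_ge:
  "exp (- 4 * sqrt (real (card (center D))))
    \<le> real (num_syt D) / (real (card D choose card (center D)) * real (num_syt (external_hook D)) * real (num_syt (center D)))"
proof -
  \<comment> \<open>The loss in the exponent from the row alone; the column loses the same
    amount.\<close>
  define t where "t = 2 * sqrt (real (card (center D)))"
  have pos: "real (hook_prod D (trunc_row D)) > 0" "real (hook_prod D (trunc_column D)) > 0"
    unfolding of_nat_0_less_iff by (rule hook_prod_pos; force simp: mem_trunc_row mem_trunc_column)+
  have "exp (- t) \<le> real (hook_prod (trunc_row D) (trunc_row D)) / real (hook_prod D (trunc_row D))"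
    using hook_prod_row_le pos by (simp add: t_def exp_minus field_simps)
  moreover have "exp (- t) \<le> real (hook_prod (trunc_column D) (trunc_column D)) / real (hook_prod D (trunc_column D))"
    using hook_prod_column_le pos by (simp add: t_def exp_minus field_simps)
  ultimately have "exp (- t) * exp (- t) \<le>
      (real (hook_prod (trunc_row D) (trunc_row D)) / real (hook_prod D (trunc_row D)))
      * (real (hook_prod (trunc_column D) (trunc_column D)) / real (hook_prod D (trunc_column D)))"
    by (intro mult_mono) auto
  moreover have "exp (- t) * exp (- t) = exp (- 4 * sqrt (real (card (center D))))"
    by (simp add: t_def flip: exp_add)
  ultimately show ?thesis unfolding num_syt_ratio_eq by simp
qed

end

section \<open>Diagrams of partitions given as lists\<close>

lemma diagram_eq_Sigma:
  "diagram lam = prod.swap ` (SIGMA y:{1..int (length lam)}. {1..int (lam ! nat (y - 1))})"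
  \<comment> \<open>Boxes are pairs of column and row, while the row indexes the dependent product;
    hence the swap.\<close>
  by (force simp: diagram_def)

lemma card_diagram: "card (diagram lam) = sum_list lam"
proof -
  have "card (diagram lam) = (\<Sum>y\<in>{1..int (length lam)}. lam ! nat (y - 1))"
    unfolding diagram_eq_Sigma by (simp add: card_image)
  also have "\<dots> = (\<Sum>i=0..<length lam. lam ! i)"
    by (rule sum.reindex_bij_witness[of _ "\<lambda>i. int i + 1" "\<lambda>y. nat (y - 1)"]) auto
  finally show ?thesis by (simp add: sum_list_sum_nth)
qed

lemma young_diagram_diagram:
  assumes "is_partition lam" "lam \<noteq> []"
  shows "young_diagram (diagram lam)"
proof
  show "finite (diagram lam)" unfolding diagram_eq_Sigma by simp
  have "(1, 1) \<in> diagram lam"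
    using assms by (cases lam) (auto simp: diagram_def is_partition_def)
  then show "diagram lam \<noteq> {}" by blast
  show "(x', y') \<in> diagram lam"
    if "(x, y) \<in> diagram lam" "1 \<le> x'" "x' \<le> x" "1 \<le> y'" "y' \<le> y" for x y x' y'
  proof -
    have "lam ! nat (y - 1) \<le> lam ! nat (y' - 1)"
    \<comment> \<open>\<open>sorted_wrt\<close> compares only distinct positions, so equal rows form
      a separate case.\<close>
    proof (cases "y' = y")
      case False
      then show ?thesis
        using assms(1) that sorted_wrt_nth_less[of "(\<ge>)" lam "nat (y' - 1)" "nat (y - 1)"]
        by (auto simp: is_partition_def diagram_def)
    qed simp
    then show ?thesis using that by (auto simp: diagram_def)
  qed
qed (auto simp: diagram_def)

theorem proposition3p8:
  fixes lam :: "nat list" and n :: nat and L s c a b :: "box set"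
  assumes "is_partition lam" and "lam \<noteq> []" and "n = sum_list lam"
    and "L = diagram lam"
    and "s = external_hook L" and "c = center L"
    and "a = trunc_row L" and "b = trunc_column L"
  shows "real (hook_prod L L) =
           fact (card s) / real ((card s - 1) choose card b)
           * (real (hook_prod L a) / real (hook_prod a a))
           * (real (hook_prod L b) / real (hook_prod b b))
           * real (hook_prod c c)
    \<and> real (num_syt L) / (real (n choose card c) * real (num_syt s) * real (num_syt c)) =
           (real (hook_prod a a) / real (hook_prod L a))
           * (real (hook_prod b b) / real (hook_prod L b))
    \<and> real (num_syt L) / (real (n choose card c) * real (num_syt s) * real (num_syt c))
           \<ge> exp (- 6 * sqrt (real (card c)))"
proof -
  interpret young_diagram L
    unfolding assms(4) by (rule young_diagram_diagram[OF assms(1,2)])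
  have n: "n = card L" using assms(3,4) by (simp add: card_diagram)
  \<comment> \<open>Weakens the bound with constant 4 to the one claimed.\<close>
  have "exp (- 6 * sqrt (real (card c))) \<le> exp (- 4 * sqrt (real (card c)))" by simp
  then show ?thesis
    using hook_prod_eq num_syt_ratio_eq num_syt_ratio_ge unfolding n assms(5-8) by linarith
qed

end
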